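(* Let $X$ be an infinite set, $\mathscr{L}$ a relational language, $\kappa$ an infinite ordinal, and let $\mu$ be a probability $\kappa$-measure on $\mathrm{Str}^\kappa_{\mathscr{L}}(X)$. Then $\mathcal{O}^+(\mu)$ has the countable chain condition.
   Context: $\mathrm{Str}_{\mathscr{L}}(X)$ is the set of $\mathscr{L}$-structures with underlying set $X$. An $\mathscr{L}$-literal is an atomic formula or a (possibly iterated) negation of one. $\sigma_\kappa(\mathrm{Str}_{\mathscr{L}}(X))$ is the smallest family of subsets of $\mathrm{Str}_{\mathscr{L}}(X)$ closed under complements and under unions of size $\le\kappa$ and containing all sets $\{\mathcal{M}:\mathcal{M}\models\varphi(\bar a)\}$ for $\varphi$ a literal and $\bar a$ a tuple from $X$. $\mathrm{Str}^\kappa_{\mathscr{L}}(X)$ is $\mathrm{Str}_{\mathscr{L}}(X)$ with this family of measurable sets. A probability $\kappa$-measure on it is a probability measure $\mu$ with $\mu(\bigcup_{i\in\kappa}A_i)=\sum_{i\in\kappa}\mu(A_i)$ for pairwise disjoint measurable $A_i$. The set $\mathbb{B}^\kappa_{\mathscr{L}:X}$ of $\kappa$-Borel codes is the smallest set containing the basic codes $\langle 0,\varphi,\bar a\rangle$ ($\varphi$ a finite conjunction of $\mathscr{L}$-literals, $\bar a$ a tuple from $X$) and closed under formal negation $\neg\gamma$ and formal $\bigvee\Gamma$, $\bigwedge\Gamma$ for $\Gamma=\{\gamma_i\}_{i\in\kappa}$. The interpretation $\mathrm{Int}(\gamma)\subseteq\mathrm{Str}_{\mathscr{L}}(X)$ interprets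 basic codes as $\{\mathcal{M}:\mathcal{M}\models\varphi(\bar a)\}$ and $\neg,\bigvee,\bigwedge$ as complement, union, intersection. $\mu(\gamma)=\mu(\mathrm{Int}(\gamma))$. $\gamma\preceq_\mu\zeta$ means $\mu(\gamma\wedge\neg\zeta)=0$, and $\mathcal{O}^+(\mu)=(\{\gamma\in\mathbb{B}^\kappa_{\mathscr{L}:X}:\mu(\gamma)>0\},\preceq_\mu)$, a pre-order used as a forcing notion (smaller is stronger). Two elements are incompatible if no element of $\mathcal{O}^+(\mu)$ is below both; the countable chain condition says every set of pairwise incompatible elements is countable. *)

theory Defs
  imports "HOL-Probability.Probability"
begin

unbundle cardinal_syntax

text \<open>
  A relational language is a set \<open>L\<close> of relation symbols with an arity function \<open>ar\<close>.
  Logical equality is an atomic formula. An ordinal \<open>\<kappa>\<close> is given by a well-order, whose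
  elements are those of \<open>Field \<kappa>\<close>.
\<close>

datatype 'r lit =
    LEq nat nat
  | LRel 'r "nat list"
  | LNeg "'r lit"

text \<open>\<open>lit_wf L ar n l\<close>: \<open>l\<close> is a literal over \<open>(L, ar)\<close> with variables among
  \<open>x\<^sub>0, \<dots>, x\<^bsub>n-1\<^esub>\<close>.\<close>

primrec lit_wf :: "'r set \<Rightarrow> ('r \<Rightarrow> nat) \<Rightarrow> nat \<Rightarrow> 'r lit \<Rightarrow> bool" where
  "lit_wf L ar n (LEq i j) \<longleftrightarrow> i < n \<and> j < n"
| "lit_wf L ar n (LRel R vs) \<longleftrightarrow> R \<in> L \<and> length vs = ar R \<and> (\<forall>v \<in> set vs. v < n)"
| "lit_wf L ar n (LNeg l) \<longleftrightarrow> lit_wf L ar n l"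

type_synonym ('r, 'a) struct = "'r \<Rightarrow> 'a list set"

text \<open>Emptiness outside \<open>L\<close> makes each structure on \<open>X\<close> have exactly one representative.\<close>

definition Str :: "'r set \<Rightarrow> ('r \<Rightarrow> nat) \<Rightarrow> 'a set \<Rightarrow> ('r, 'a) struct set" where
  "Str L ar X = {M. (\<forall>R \<in> L. M R \<subseteq> {as. length as = ar R \<and> set as \<subseteq> X}) \<and>
                    (\<forall>R. R \<notin> L \<longrightarrow> M R = {})}"

text \<open>The variable \<open>x\<^sub>i\<close> is interpreted by the entry \<open>as ! i\<close> of the tuple \<open>as\<close>.\<close>

primrec sat :: "('r, 'a) struct \<Rightarrow> 'a list \<Rightarrow> 'r lit \<Rightarrow> bool" where
  "sat M as (LEq i j) \<longleftrightarrow> as ! i = as ! j"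
| "sat M as (LRel R vs) \<longleftrightarrow> map (\<lambda>v. as ! v) vs \<in> M R"
| "sat M as (LNeg l) \<longleftrightarrow> \<not> sat M as l"

inductive_set sigma_kappa ::
    "'k rel \<Rightarrow> 'r set \<Rightarrow> ('r \<Rightarrow> nat) \<Rightarrow> 'a set \<Rightarrow> ('r, 'a) struct set set"
  for \<kappa> :: "'k rel" and L :: "'r set" and ar :: "'r \<Rightarrow> nat" and X :: "'a set" where
  basic: "set as \<subseteq> X \<Longrightarrow> lit_wf L ar (length as) l \<Longrightarrow>
    {M \<in> Str L ar X. sat M as l} \<in> sigma_kappa \<kappa> L ar X"
| compl: "A \<in> sigma_kappa \<kappa> L ar X \<Longrightarrow> Str L ar X - A \<in> sigma_kappa \<kappa> L ar X"
| union: "(\<forall>A \<in> F. A \<in> sigma_kappa \<kappa> L ar X) \<Longrightarrow> |F| \<le>o |Field \<kappa>| \<Longrightarrow>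
    \<Union>F \<in> sigma_kappa \<kappa> L ar X"

definition prob_kappa_measure ::
    "'k rel \<Rightarrow> 'r set \<Rightarrow> ('r \<Rightarrow> nat) \<Rightarrow> 'a set \<Rightarrow> ('r, 'a) struct measure \<Rightarrow> bool" where
  "prob_kappa_measure \<kappa> L ar X \<mu> \<longleftrightarrow>
     prob_space \<mu> \<and> space \<mu> = Str L ar X \<and> sets \<mu> = sigma_kappa \<kappa> L ar X \<and>
     (\<forall>A. (\<forall>i \<in> Field \<kappa>. A i \<in> sets \<mu>) \<longrightarrow> disjoint_family_on A (Field \<kappa>) \<longrightarrow>
        emeasure \<mu> (\<Union>i \<in> Field \<kappa>. A i) = (\<Sum>\<^sub>\<infinity>i \<in> Field \<kappa>. emeasure \<mu> (A i)))"

text \<open>In a basic code, the list of literals stands for its conjunction.\<close>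

datatype ('r, 'a, 'k) bcode =
    Basic "'r lit list" "'a list"
  | Neg "('r, 'a, 'k) bcode"
  | Disj "'k \<Rightarrow> ('r, 'a, 'k) bcode"
  | Conj "'k \<Rightarrow> ('r, 'a, 'k) bcode"

text \<open>Families indexed by \<open>\<kappa>\<close> are functions on \<open>'k\<close> that are \<open>extensional\<close> on \<open>Field \<kappa>\<close>, so that
  their values outside \<open>Field \<kappa>\<close> do not produce spurious distinct codes.\<close>

inductive_set borel_codes ::
    "'k rel \<Rightarrow> 'r set \<Rightarrow> ('r \<Rightarrow> nat) \<Rightarrow> 'a set \<Rightarrow> ('r, 'a, 'k) bcode set"
  for \<kappa> :: "'k rel" and L :: "'r set" and ar :: "'r \<Rightarrow> nat" and X :: "'a set" where
  Basic: "set as \<subseteq> X \<Longrightarrow> (\<forall>l \<in> set ls. lit_wf L ar (length as) l) \<Longrightarrow>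
    Basic ls as \<in> borel_codes \<kappa> L ar X"
| Neg: "\<gamma> \<in> borel_codes \<kappa> L ar X \<Longrightarrow> Neg \<gamma> \<in> borel_codes \<kappa> L ar X"
| Disj: "(\<forall>i \<in> Field \<kappa>. \<Gamma> i \<in> borel_codes \<kappa> L ar X) \<Longrightarrow> \<Gamma> \<in> extensional (Field \<kappa>) \<Longrightarrow>
    Disj \<Gamma> \<in> borel_codes \<kappa> L ar X"
| Conj: "(\<forall>i \<in> Field \<kappa>. \<Gamma> i \<in> borel_codes \<kappa> L ar X) \<Longrightarrow> \<Gamma> \<in> extensional (Field \<kappa>) \<Longrightarrow>
    Conj \<Gamma> \<in> borel_codes \<kappa> L ar X"

primrec interp ::
    "'k rel \<Rightarrow> 'r set \<Rightarrow> ('r \<Rightarrow> nat) \<Rightarrow> 'a set \<Rightarrow> ('r, 'a, 'k) bcode \<Rightarrow> ('r, 'a) struct set" where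
  "interp \<kappa> L ar X (Basic ls as) = {M \<in> Str L ar X. \<forall>l \<in> set ls. sat M as l}"
| "interp \<kappa> L ar X (Neg \<gamma>) = Str L ar X - interp \<kappa> L ar X \<gamma>"
| "interp \<kappa> L ar X (Disj \<Gamma>) = (\<Union>i \<in> Field \<kappa>. interp \<kappa> L ar X (\<Gamma> i))"
| "interp \<kappa> L ar X (Conj \<Gamma>) = (\<Inter>i \<in> Field \<kappa>. interp \<kappa> L ar X (\<Gamma> i))"

text \<open>The binary conjunction \<open>\<gamma> \<and> \<zeta>\<close> is the formal conjunction of the \<open>\<kappa>\<close>-indexed family whose
  entry at the least index is \<open>\<gamma>\<close> and whose other entries are all \<open>\<zeta>\<close>.\<close>

definition code_and :: "'k rel \<Rightarrow> ('r, 'a, 'k) bcode \<Rightarrow> ('r, 'a, 'k) bcode \<Rightarrow> ('r, 'a, 'k) bcode" where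
  "code_and \<kappa> \<gamma> \<zeta> =
     Conj (\<lambda>i \<in> Field \<kappa>. if i = wo_rel.minim \<kappa> (Field \<kappa>) then \<gamma> else \<zeta>)"

lemma code_and_in_borel_codes:
  assumes "\<gamma> \<in> borel_codes \<kappa> L ar X" "\<zeta> \<in> borel_codes \<kappa> L ar X"
  shows "code_and \<kappa> \<gamma> \<zeta> \<in> borel_codes \<kappa> L ar X"
  unfolding code_and_def using assms by (intro borel_codes.Conj) auto

lemma interp_code_and:
  assumes "Well_order \<kappa>" "infinite (Field \<kappa>)"
  shows "interp \<kappa> L ar X (code_and \<kappa> \<gamma> \<zeta>) = interp \<kappa> L ar X \<gamma> \<inter> interp \<kappa> L ar X \<zeta>"
proof -
  let ?m = "wo_rel.minim \<kappa> (Field \<kappa>)"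
  have "Field \<kappa> \<noteq> {}" using assms(2) by auto
  then have m: "?m \<in> Field \<kappa>"
    using assms(1) by (intro wo_rel.minim_in) (auto simp: wo_rel_def)
  obtain j where j: "j \<in> Field \<kappa>" "j \<noteq> ?m"
    using assms(2) by (metis finite.emptyI finite.insertI finite_subset insertI1 subsetI)
  show ?thesis
    unfolding code_and_def using m j by (auto split: if_splits)
qed

definition code_prob ::
    "'k rel \<Rightarrow> 'r set \<Rightarrow> ('r \<Rightarrow> nat) \<Rightarrow> 'a set \<Rightarrow> ('r, 'a) struct measure \<Rightarrow>
     ('r, 'a, 'k) bcode \<Rightarrow> real" where
  "code_prob \<kappa> L ar X \<mu> \<gamma> = measure \<mu> (interp \<kappa> L ar X \<gamma>)"

definition code_le ::
    "'k rel \<Rightarrow> 'r set \<Rightarrow> ('r \<Rightarrow> nat) \<Rightarrow> 'a set \<Rightarrow> ('r, 'a) struct measure \<Rightarrow>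
     ('r, 'a, 'k) bcode \<Rightarrow> ('r, 'a, 'k) bcode \<Rightarrow> bool" where
  "code_le \<kappa> L ar X \<mu> \<gamma> \<zeta> \<longleftrightarrow> code_prob \<kappa> L ar X \<mu> (code_and \<kappa> \<gamma> (Neg \<zeta>)) = 0"

definition O_plus ::
    "'k rel \<Rightarrow> 'r set \<Rightarrow> ('r \<Rightarrow> nat) \<Rightarrow> 'a set \<Rightarrow> ('r, 'a) struct measure \<Rightarrow>
     ('r, 'a, 'k) bcode set" where
  "O_plus \<kappa> L ar X \<mu> = {\<gamma> \<in> borel_codes \<kappa> L ar X. code_prob \<kappa> L ar X \<mu> \<gamma> > 0}"

definition incompatible :: "'p set \<Rightarrow> ('p \<Rightarrow> 'p \<Rightarrow> bool) \<Rightarrow> 'p \<Rightarrow> 'p \<Rightarrow> bool" where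
  "incompatible P le p q \<longleftrightarrow> \<not> (\<exists>r \<in> P. le r p \<and> le r q)"

definition ccc :: "'p set \<Rightarrow> ('p \<Rightarrow> 'p \<Rightarrow> bool) \<Rightarrow> bool" where
  "ccc P le \<longleftrightarrow> (\<forall>A \<subseteq> P. pairwise (incompatible P le) A \<longrightarrow> countable A)"

end

theory Submission
  imports Defs
begin

text \<open>
  Incompatible codes have interpretations that meet in a null set, since otherwise their
  conjunction would be a common lower bound of positive measure. A probability space has only
  countably many pairwise almost disjoint sets of positive measure, because finite partial sums of
  their measures are at most \<open>1\<close>.
\<close>

text \<open>Induction on \<open>I\<close>: the new set overlaps the union of the others in a finite
  union of null sets, so additivity survives. Null overlap replaces disjointness because
  incompatible codes may still share structures.\<close>

lemma (in finite_measure) measure_UNION_null_inter: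
  assumes "finite I" "\<And>i. i \<in> I \<Longrightarrow> B i \<in> sets M"
    and "pairwise (\<lambda>i j. measure M (B i \<inter> B j) = 0) I"
  shows "measure M (\<Union>i\<in>I. B i) = (\<Sum>i\<in>I. measure M (B i))"
  using assms
proof (induction I rule: finite_induct)
  case (insert x I)
  have UN: "(\<Union>i\<in>I. B i) \<in> sets M"
    using insert.hyps insert.prems by (auto intro: sets.finite_UN)
  have "measure M (B x \<inter> (\<Union>i\<in>I. B i)) \<le> measure M (\<Union>i\<in>I. B x \<inter> B i)"
    using insert.hyps insert.prems by (intro finite_measure_mono sets.finite_UN) auto
  also have "\<dots> \<le> (\<Sum>i\<in>I. measure M (B x \<inter> B i))"
    using insert.hyps insert.prems by (intro finite_measure_subadditive_finite) auto
  \<comment> \<open>Since \<open>x\<close> is not in \<open>I\<close>, each pair \<open>x\<close>,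
    \<open>i\<close> is a pair of distinct indices, to which the \<open>pairwise\<close> hypothesis
    applies.\<close>
  also have "\<dots> = 0"
    using insert.hyps insert.prems by (intro sum.neutral) (auto simp: pairwise_def)
  finally have "measure M (B x \<inter> (\<Union>i\<in>I. B i)) = 0"
    by (simp add: measure_le_0_iff)
  \<comment> \<open>Split off the part of the union outside \<open>B x\<close>; removing the null
    overlap does not change the measure of the union.\<close>
  then have "measure M (B x \<union> (\<Union>i\<in>I. B i)) = measure M (B x) + measure M (\<Union>i\<in>I. B i)"
    using finite_measure_Union'[of "B x" "\<Union>i\<in>I. B i"] finite_measure_Diff'[of "\<Union>i\<in>I. B i" "B x"]
      insert.prems(1) UN by (simp add: Int_commute)
  moreover have "pairwise (\<lambda>i j. measure M (B i \<inter> B j) = 0) I"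
    using insert.prems(2) by (rule pairwise_subset) auto
  ultimately show ?case
    using insert by simp
qed simp

text \<open>The measure of the space bounds all finite partial sums, so the nonnegative family is
  summable, and a summable real family has only countably many nonzero terms.\<close>

lemma (in finite_measure) countable_null_inter:
  assumes B: "\<And>i. i \<in> I \<Longrightarrow> B i \<in> sets M" "\<And>i. i \<in> I \<Longrightarrow> measure M (B i) > 0"
    and null: "pairwise (\<lambda>i j. measure M (B i \<inter> B j) = 0) I"
  shows "countable I"
proof -
  have "(\<Sum>i\<in>F. measure M (B i)) \<le> measure M (space M)" if "finite F" "F \<subseteq> I" for F
  proof -
    have "(\<Sum>i\<in>F. measure M (B i)) = measure M (\<Union>i\<in>F. B i)"
      using that B(1) pairwise_subset[OF null]
      by (intro measure_UNION_null_inter[symmetric]) auto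
    then show ?thesis by (simp add: bounded_measure)
  qed
  then have "(\<lambda>i. measure M (B i)) summable_on I"
    by (intro nonneg_bdd_above_summable_on bdd_aboveI) auto
  then have "countable {i \<in> I. measure M (B i) \<noteq> 0}"
    by (rule summable_countable_real)
  moreover have "{i \<in> I. measure M (B i) \<noteq> 0} = I"
    using B(2) by force
  ultimately show ?thesis by simp
qed

lemma sigma_kappa_UN:
  assumes "\<And>i. i \<in> Field \<kappa> \<Longrightarrow> B i \<in> sigma_kappa \<kappa> L ar X"
  shows "(\<Union>i\<in>Field \<kappa>. B i) \<in> sigma_kappa \<kappa> L ar X"
  using assms by (intro sigma_kappa.union) (auto simp: card_of_image)

text \<open>Induction on codes. Nonemptiness of \<open>Field \<kappa>\<close> matters for
  \<open>Conj\<close>: an intersection over no indices would be \<open>UNIV\<close> instead of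
  \<open>Str L ar X\<close>.\<close>

lemma interp_in_sets:
  assumes \<mu>: "prob_kappa_measure \<kappa> L ar X \<mu>" and ne: "Field \<kappa> \<noteq> {}"
    and "\<gamma> \<in> borel_codes \<kappa> L ar X"
  shows "interp \<kappa> L ar X \<gamma> \<in> sets \<mu>"
  using assms(3)
proof (induction rule: borel_codes.induct)
  have sets: "sets \<mu> = sigma_kappa \<kappa> L ar X" and space: "space \<mu> = Str L ar X"
    using \<mu> by (auto simp: prob_kappa_measure_def)
  {
    case (Basic as ls)
    from Basic(2) show ?case
    proof (induction ls)
      case Nil
      \<comment> \<open>The empty conjunction holds in every structure, so its interpretation is the
        whole space.\<close>
      show ?case using sets.top[of \<mu>] space by simp
    next
      case (Cons l ls)
      have "{M \<in> Str L ar X. sat M as l} \<in> sets \<mu>"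
        unfolding sets using Basic(1) Cons.prems by (auto intro: sigma_kappa.basic)
      moreover have "interp \<kappa> L ar X (Basic ls as) \<in> sets \<mu>"
        using Cons by simp
      ultimately have "{M \<in> Str L ar X. sat M as l} \<inter> interp \<kappa> L ar X (Basic ls as) \<in> sets \<mu>"
        by (rule sets.Int)
      moreover have "{M \<in> Str L ar X. sat M as l} \<inter> interp \<kappa> L ar X (Basic ls as)
          = interp \<kappa> L ar X (Basic (l # ls) as)"
        by auto
      ultimately show ?case by simp
    qed
  next
    case (Neg \<gamma>)
    then show ?case by (simp add: sets sigma_kappa.compl)
  next
    case (Disj \<Gamma>)
    then show ?case by (simp add: sets sigma_kappa_UN)
  next
    case (Conj \<Gamma>)
    \<comment> \<open>Complements are relative to \<open>Str L ar X\<close>, so De Morgan's law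
      needs each interpretation to lie inside it; this reduces intersections to the closure under
      \<kappa>-unions.\<close>
    then have "interp \<kappa> L ar X (\<Gamma> i) \<subseteq> Str L ar X" if "i \<in> Field \<kappa>" for i
      using that sets.sets_into_space space by metis
    then have "(\<Inter>i\<in>Field \<kappa>. interp \<kappa> L ar X (\<Gamma> i))
        = Str L ar X - (\<Union>i\<in>Field \<kappa>. Str L ar X - interp \<kappa> L ar X (\<Gamma> i))"
      using ne by auto
    moreover have "\<dots> \<in> sigma_kappa \<kappa> L ar X"
      using Conj by (intro sigma_kappa.compl sigma_kappa_UN) (auto simp: sets)
    ultimately show ?case by (simp add: sets)
  }
qed

lemma incompatible_null_inter:
  assumes "Well_order \<kappa>" "infinite (Field \<kappa>)"
    and \<gamma>: "\<gamma> \<in> borel_codes \<kappa> L ar X" "\<zeta> \<in> borel_codes \<kappa> L ar X"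
    and inc: "incompatible (O_plus \<kappa> L ar X \<mu>) (code_le \<kappa> L ar X \<mu>) \<gamma> \<zeta>"
  shows "measure \<mu> (interp \<kappa> L ar X \<gamma> \<inter> interp \<kappa> L ar X \<zeta>) = 0"
proof (rule ccontr)
  note interp_and = interp_code_and[OF assms(1,2)]
  let ?r = "code_and \<kappa> \<gamma> \<zeta>"
  assume "measure \<mu> (interp \<kappa> L ar X \<gamma> \<inter> interp \<kappa> L ar X \<zeta>) \<noteq> 0"
  then have "?r \<in> O_plus \<kappa> L ar X \<mu>"
    using code_and_in_borel_codes[OF \<gamma>]
    by (simp add: O_plus_def code_prob_def interp_and zero_less_measure_iff)
  moreover have "code_le \<kappa> L ar X \<mu> ?r \<gamma>" "code_le \<kappa> L ar X \<mu> ?r \<zeta>"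
  proof -
    \<comment> \<open>\<open>U\<close> will be \<open>Str L ar X\<close>, from the interpretation of
      \<open>Neg\<close>. The conjunction lies below both codes because the difference sets are
      empty.\<close>
    have "(S \<inter> T) \<inter> (U - S) = {}" "(S \<inter> T) \<inter> (U - T) = {}" for S T U :: "('b, 'c) struct set"
      by auto
    then show "code_le \<kappa> L ar X \<mu> ?r \<gamma>" "code_le \<kappa> L ar X \<mu> ?r \<zeta>"
      by (simp_all add: code_le_def code_prob_def interp_and)
  qed
  ultimately show False
    using inc by (auto simp: incompatible_def)
qed

theorem proposition6p7:
  fixes X :: "'a set" and L :: "'r set" and ar :: "'r \<Rightarrow> nat"
    and \<kappa> :: "'k rel" and \<mu> :: "('r, 'a) struct measure"
  assumes "infinite X"
    and "Well_order \<kappa>" and "infinite (Field \<kappa>)"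
    and "prob_kappa_measure \<kappa> L ar X \<mu>"
  shows "ccc (O_plus \<kappa> L ar X \<mu>) (code_le \<kappa> L ar X \<mu>)"
  unfolding ccc_def
proof (intro allI impI)
  fix A
  assume A: "A \<subseteq> O_plus \<kappa> L ar X \<mu>"
    and inc: "pairwise (incompatible (O_plus \<kappa> L ar X \<mu>) (code_le \<kappa> L ar X \<mu>)) A"
  interpret prob_space \<mu>
    using assms(4) by (simp add: prob_kappa_measure_def)
  have codes: "\<gamma> \<in> borel_codes \<kappa> L ar X" if "\<gamma> \<in> A" for \<gamma>
    using A that by (auto simp: O_plus_def)
  show "countable A"
  \<comment> \<open>The index set is \<open>A\<close> itself, so codes are counted directly and not
    through their interpretations.\<close>
  proof (rule countable_null_inter[where B = "interp \<kappa> L ar X"])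
    show "interp \<kappa> L ar X \<gamma> \<in> sets \<mu>" if "\<gamma> \<in> A" for \<gamma>
      using infinite_imp_nonempty[OF assms(3)] by (rule interp_in_sets[OF assms(4) _ codes[OF that]])
    show "measure \<mu> (interp \<kappa> L ar X \<gamma>) > 0" if "\<gamma> \<in> A" for \<gamma>
      using A that by (auto simp: O_plus_def code_prob_def)
    show "pairwise (\<lambda>\<gamma> \<zeta>. measure \<mu> (interp \<kappa> L ar X \<gamma> \<inter> interp \<kappa> L ar X \<zeta>) = 0) A"
      using inc incompatible_null_inter[OF assms(2,3) codes codes]
      unfolding pairwise_def by blast
  qed
qed

end
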